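(* Let $U$ and $W$ be $\mathbb{R}$-linear spaces, let $\pi : U \to W$ be an $\mathbb{R}$-linear map, and let $G$ be a group acting on $U$ and on $W$ by $\mathbb{R}$-linear automorphisms such that $g \circ \pi = \pi \circ g$ for all $g \in G$. Assume that $m := \dim \ker \pi \in \mathbb{N}$ (in particular $\ker\pi$ is finite dimensional) and that $G$ is generated by a finite subset $\{g_1,\dots,g_d\}$. Then \[ \dim \pi(U)^G / \pi(U^G) \le md . \] Moreover, $\dim \pi(U)^G/\pi(U^G) = md$ if and only if the following two conditions both hold: (i) $\ker \pi \subset U^G$; and (ii) $(\ker \pi)^d \subset \bar{g}(U)$, where $\bar{g} : U \to U^d$ is the linear map given by $(\bar{g}u)_i = g_i u - u$ for $i=1,\dots,d$.
   Context: $U^G := \{u \in U : g(u) = u \ \forall g \in G\}$ and $W^G := \{w \in W : g(w) = w \ \forall g \in G\}$ are the subspaces of $G$-invariant elements. $\pi(U)^G := \pi(U) \cap W^G$, and $\pi(U^G)$ is the image of $U^G$ under $\pi$; since $\pi$ commutes with $G$, $\pi(U^G) \subset \pi(U)^G$. Dimensions are over $\mathbb{R}$. $(\ker\pi)^d \subset U^d$ is the $d$-fold product of $\ker \pi$. *)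

theory Defs
  imports "HOL-Algebra.Group_Action" "HOL-Algebra.Generated_Groups"
    "Jordan_Normal_Form.VS_Connect"
begin

definition linear_action :: "('g, 'b) monoid_scheme \<Rightarrow> ('g \<Rightarrow> 'v::real_vector \<Rightarrow> 'v) \<Rightarrow> bool" where
  "linear_action G \<phi> \<longleftrightarrow> group_action G UNIV \<phi> \<and> (\<forall>g\<in>carrier G. linear (\<phi> g))"

definition fixed_space :: "('g, 'b) monoid_scheme \<Rightarrow> ('g \<Rightarrow> 'v \<Rightarrow> 'v) \<Rightarrow> 'v set" where
  "fixed_space G \<phi> = {v. \<forall>g\<in>carrier G. \<phi> g v = v}"

definition lin_kernel :: "('u \<Rightarrow> 'w::zero) \<Rightarrow> 'u set" where
  "lin_kernel \<pi> = {u. \<pi> u = 0}"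

text \<open>The quotient \<open>A / B\<close> of a subspace \<open>A\<close> by a subspace \<open>B \<subseteq> A\<close>: the real vector space
  whose elements are the cosets \<open>a + B\<close>. The summand \<open>b\<close> in the scalar multiplication makes
  \<open>0 \<odot> X = B\<close>. The ring fields \<open>mult\<close> and \<open>one\<close> of the record play no role for modules.\<close>

definition quotient_space :: "'w::real_vector set \<Rightarrow> 'w set \<Rightarrow> (real, 'w set) module" where
  "quotient_space A B =
    \<lparr> carrier = {{a + b | b. b \<in> B} | a. a \<in> A},
      mult = undefined, one = undefined,
      zero = B,
      add = (\<lambda>X Y. {x + y | x y. x \<in> X \<and> y \<in> Y}),
      smult = (\<lambda>c X. {c *\<^sub>R x + b | x b. x \<in> X \<and> b \<in> B}) \<rparr>"

abbreviation quotient_fin_dim :: "'w::real_vector set \<Rightarrow> 'w set \<Rightarrow> bool" where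
  "quotient_fin_dim A B \<equiv> vectorspace.fin_dim (class_ring :: real ring) (quotient_space A B)"

abbreviation quotient_dim :: "'w::real_vector set \<Rightarrow> 'w set \<Rightarrow> nat" where
  "quotient_dim A B \<equiv> vectorspace.dim (class_ring :: real ring) (quotient_space A B)"

text \<open>The product \<open>U\<^sup>d\<close> is the set of extensional functions on \<open>{1..d}\<close>.\<close>

definition displacement ::
    "('g \<Rightarrow> 'u::real_vector \<Rightarrow> 'u) \<Rightarrow> nat \<Rightarrow> (nat \<Rightarrow> 'g) \<Rightarrow> 'u \<Rightarrow> nat \<Rightarrow> 'u" where
  "displacement \<phi> d g u = (\<lambda>i\<in>{1..d}. \<phi> (g i) u - u)"

lemma coset_add:
  fixes B :: "'w::real_vector set"
  assumes "real_vector.subspace B"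
  shows "{x + y | x y. x \<in> {a + b | b. b \<in> B} \<and> y \<in> {a' + b | b. b \<in> B}} = {(a + a') + b | b. b \<in> B}"
    (is "?L = ?R")
proof (rule equalityI; rule subsetI)
  fix z assume "z \<in> ?L"
  then obtain b b' where b: "b \<in> B" "b' \<in> B" "z = a + b + (a' + b')" by blast
  then have "z = a + a' + (b + b')" by simp
  then show "z \<in> ?R" using b real_vector.subspace_add[OF assms] by blast
next
  fix z assume "z \<in> ?R"
  then obtain b where b: "b \<in> B" "z = (a + 0) + (a' + b)" by auto
  then show "z \<in> ?L" using real_vector.subspace_0[OF assms] by blast
qed

lemma coset_scale:
  fixes B :: "'w::real_vector set"
  assumes "real_vector.subspace B"
  shows "{c *\<^sub>R x + b' | x b'. x \<in> {a + b | b. b \<in> B} \<and> b' \<in> B} = {c *\<^sub>R a + b | b. b \<in> B}"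
    (is "?L = ?R")
proof (rule equalityI; rule subsetI)
  fix z assume "z \<in> ?L"
  then obtain b b' where b: "b \<in> B" "b' \<in> B" "z = c *\<^sub>R (a + b) + b'" by blast
  then have "z = c *\<^sub>R a + (c *\<^sub>R b + b')" by (simp add: scaleR_add_right)
  then show "z \<in> ?R"
    using b real_vector.subspace_add[OF assms] real_vector.subspace_scale[OF assms] by blast
next
  fix z assume "z \<in> ?R"
  then obtain b where b: "b \<in> B" "z = c *\<^sub>R (a + 0) + b" by auto
  then show "z \<in> ?L" using real_vector.subspace_0[OF assms] by blast
qed

lemma vectorspace_quotient_space:
  fixes A B :: "'w::real_vector set"
  assumes A: "real_vector.subspace A" and B: "real_vector.subspace B" and BA: "B \<subseteq> A"
  shows "vectorspace (class_ring :: real ring) (quotient_space A B)"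
proof -
  let ?R = "class_ring :: real ring" and ?Q = "quotient_space A B"
  define co where "co a = {a + b | b. b \<in> B}" for a
  have carr: "carrier ?Q = co ` A" by (auto simp: quotient_space_def co_def)
  have add: "co a \<oplus>\<^bsub>?Q\<^esub> co a' = co (a + a')" for a a'
    using coset_add[OF B, of a a'] by (simp add: quotient_space_def co_def)
  have scale: "c \<odot>\<^bsub>?Q\<^esub> co a = co (c *\<^sub>R a)" for c a
    using coset_scale[OF B, of c a] by (simp add: quotient_space_def co_def)
  have zero: "\<zero>\<^bsub>?Q\<^esub> = co 0" by (simp add: quotient_space_def co_def)
  note [simp] = add scale zero
  note cl = real_vector.subspace_0[OF A] real_vector.subspace_add[OF A]
    real_vector.subspace_scale[OF A] real_vector.subspace_neg[OF A]
  have fld: "field ?R" by (rule class_field)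
  then have crg: "cring ?R" by (rule fieldE)
  have "abelian_group ?Q"
  proof (rule abelian_groupI)
    fix X assume "X \<in> carrier ?Q"
    then obtain a where "a \<in> A" "X = co a" by (auto simp: carr)
    then show "\<exists>Y\<in>carrier ?Q. Y \<oplus>\<^bsub>?Q\<^esub> X = \<zero>\<^bsub>?Q\<^esub>"
      by (intro bexI[of _ "co (- a)"]) (auto simp: carr cl)
  qed (auto simp: carr cl ac_simps intro!: imageI)
  then have "Module.module ?R ?Q"
    by (intro Module.moduleI) (auto simp: carr cl scaleR_add_left scaleR_add_right crg)
  then show ?thesis using fld by (simp add: vectorspace_def)
qed

end

theory Submission
  imports Defs "HOL-Library.Function_Algebras"
begin

text \<open>
  Let \<open>K = ker \<pi>\<close>, let \<open>f u\<close> be the \<open>d\<close>-tuple of displacements \<open>g\<^sub>i u - u\<close>, and let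
  \<open>V\<close> be the preimage of \<open>W\<^sup>G\<close> under \<open>\<pi>\<close>. Because the \<open>g\<^sub>i\<close> generate \<open>G\<close>, a vector is
  invariant as soon as all \<open>g\<^sub>i\<close> fix it (\<open>fixed_space_generate\<close>). On \<open>U\<close> this says that
  \<open>ker f = U\<^sup>G\<close>. On \<open>W\<close>, combined with the equivariance of \<open>\<pi>\<close>, it says that \<open>V\<close> consists
  of the vectors all of whose displacements lie in \<open>K\<close>, that is, \<open>V\<close> is the preimage of \<open>K\<^sup>d\<close>
  under \<open>f\<close>. Hence
  \<open>\<pi>(U)\<^sup>G / \<pi>(U\<^sup>G) = \<pi>(V) / \<pi>(ker f) \<cong> V / (K + ker f) \<cong> f(V) / f(K)\<close>.

  The right-hand side is a quotient of a subspace of \<open>K\<^sup>d\<close>, which has dimension \<open>m d\<close>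
  (\<open>power_of_subspace_basis\<close>). So the dimension is at most \<open>m d\<close>, and it equals \<open>m d\<close> exactly
  when nothing is lost at either end: \<open>f(K) = 0\<close>, which is \<open>K \<subseteq> U\<^sup>G\<close>, and \<open>f(V) = K\<^sup>d\<close>, which
  is \<open>K\<^sup>d \<subseteq> f(U)\<close>. This count is \<open>quotient_dim_image_preimage\<close>, a statement on two linear
  maps in which the group no longer appears.
\<close>

section \<open>Dimension of a quotient space\<close>

text \<open>
  This is the passage from the abstract vector space of cosets to linear algebra inside \<open>A\<close>:
  linear independence and spanning of the cosets \<open>w i + B\<close> are expressed by sums of the
  vectors \<open>w i\<close> modulo \<open>B\<close>. The vectors form a family and not a set, so
  that an application need not first show that they are distinct; modulo \<open>B\<close> they are,
  by independence.
\<close>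
lemma quotient_dim_eq_card:
  fixes A B :: "'w::real_vector set" and w :: "'i \<Rightarrow> 'w"
  assumes A: "real_vector.subspace A" and B: "real_vector.subspace B" and BA: "B \<subseteq> A"
    and I: "finite I" and wA: "w ` I \<subseteq> A"
    and indep: "\<And>c i. (\<Sum>i\<in>I. c i *\<^sub>R w i) \<in> B \<Longrightarrow> i \<in> I \<Longrightarrow> c i = 0"
    and spans: "\<And>a. a \<in> A \<Longrightarrow> \<exists>c. a - (\<Sum>i\<in>I. c i *\<^sub>R w i) \<in> B"
  shows "quotient_fin_dim A B \<and> quotient_dim A B = card I"
proof -
  let ?R = "class_ring :: real ring" and ?Q = "quotient_space A B"
  interpret Q: vectorspace ?R ?Q
    by (rule vectorspace_quotient_space[OF A B BA])
  define co where "co a = {a + b | b. b \<in> B}" for a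
  have carr: "carrier ?Q = co ` A" by (auto simp: quotient_space_def co_def)
  have add: "co a \<oplus>\<^bsub>?Q\<^esub> co a' = co (a + a')" for a a'
    using coset_add[OF B, of a a'] by (simp add: quotient_space_def co_def)
  have scale: "c \<odot>\<^bsub>?Q\<^esub> co a = co (c *\<^sub>R a)" for c a
    using coset_scale[OF B, of c a] by (simp add: quotient_space_def co_def)
  have zero: "\<zero>\<^bsub>?Q\<^esub> = co 0" by (simp add: quotient_space_def co_def)
  have co_eq: "co a = co a' \<longleftrightarrow> a - a' \<in> B" for a a'
  proof
    assume "co a = co a'"
    moreover have "a \<in> co a" unfolding co_def using real_vector.subspace_0[OF B] by force
    ultimately show "a - a' \<in> B" by (auto simp: co_def)
  next
    assume *: "a - a' \<in> B"
    have "\<exists>b'. a + b = a' + b' \<and> b' \<in> B" if "b \<in> B" for b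
      using real_vector.subspace_add[OF B * that] by (intro exI[of _ "a - a' + b"]) auto
    moreover have "\<exists>b'. a' + b = a + b' \<and> b' \<in> B" if "b \<in> B" for b
      using real_vector.subspace_diff[OF B that *] by (intro exI[of _ "b - (a - a')"]) auto
    ultimately show "co a = co a'" by (auto simp: co_def)
  qed
  \<comment> \<open>If two members had the same coset, their difference would be a nontrivial combination
    in \<open>B\<close>; its coefficient at \<open>i\<close> is \<open>1\<close>.\<close>
  have inj: "inj_on (\<lambda>i. co (w i)) I"
  proof (rule inj_onI, rule ccontr)
    fix i j assume ij: "i \<in> I" "j \<in> I" "co (w i) = co (w j)" "i \<noteq> j"
    let ?c = "\<lambda>k. (if k = i then 1 else 0) - (if k = j then 1 else 0) :: real"
    have "(\<Sum>k\<in>I. ?c k *\<^sub>R w k) = w i - w j"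
      using ij I by (simp add: scaleR_diff_left sum_subtractf if_distrib[of "\<lambda>c. c *\<^sub>R _"] cong: if_cong)
    then have "?c i = 0" using indep[of ?c i] ij co_eq by simp
    then show False using ij by simp
  qed
  have lincomb: "Q.lincomb a ((\<lambda>i. co (w i)) ` J) = co (\<Sum>i\<in>J. a (co (w i)) *\<^sub>R w i)"
    if "J \<subseteq> I" for a J
  proof -
    have "finite J" using that I by (rule finite_subset)
    then show ?thesis using that
    proof (induction J)
      case empty
      show ?case by (simp add: Q.lincomb_def zero)
    next
      case (insert j J)
      have "co (w j) \<notin> (\<lambda>i. co (w i)) ` J"
        using insert.hyps insert.prems inj by (auto simp: inj_on_def)
      moreover have "co (c *\<^sub>R w i) \<in> carrier ?Q" if "i \<in> insert j J" for c i
      proof -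
        have "w i \<in> A" using that insert.prems wA by blast
        then show ?thesis using real_vector.subspace_scale[OF A] by (simp add: carr)
      qed
      ultimately show ?case
        using insert by (simp add: Q.lincomb_def scale Pi_iff add)
    qed
  qed
  let ?S = "(\<lambda>i. co (w i)) ` I"
  have S: "?S \<subseteq> carrier ?Q" using wA by (auto simp: carr)
  have "Q.lin_indpt ?S"
  proof (rule Q.finite_lin_indpt2)
    show "finite ?S" using I by simp
    show "?S \<subseteq> carrier ?Q" by (rule S)
    fix a assume "Q.lincomb a ?S = \<zero>\<^bsub>?Q\<^esub>"
    then have "(\<Sum>i\<in>I. a (co (w i)) *\<^sub>R w i) \<in> B"
      using lincomb[OF subset_refl] co_eq[of _ 0] by (simp add: zero)
    then show "\<forall>v\<in>?S. a v = \<zero>\<^bsub>?R\<^esub>" using indep by fastforce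
  qed
  moreover have "Q.span ?S = carrier ?Q"
  proof
    show "Q.span ?S \<subseteq> carrier ?Q" using S by (rule Q.span_is_subset2)
    show "carrier ?Q \<subseteq> Q.span ?S"
    proof
      fix X assume "X \<in> carrier ?Q"
      then obtain a where a: "a \<in> A" "X = co a" by (auto simp: carr)
      from spans[OF a(1)] obtain c where c: "a - (\<Sum>i\<in>I. c i *\<^sub>R w i) \<in> B" ..
      define c' where "c' = c \<circ> the_inv_into I (\<lambda>i. co (w i))"
      have "Q.lincomb c' ?S = co (\<Sum>i\<in>I. c i *\<^sub>R w i)"
        unfolding lincomb[OF subset_refl]
        by (intro arg_cong[of _ _ co] sum.cong) (simp_all add: c'_def the_inv_into_f_f[OF inj])
      then have "X = Q.lincomb c' ?S" using a c by (simp add: co_eq)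
      then show "X \<in> Q.span ?S" using I by (auto simp: Q.span_def)
    qed
  qed
  ultimately have "Q.basis ?S" using S by (simp add: Q.basis_def)
  moreover have "finite ?S" using I by simp
  ultimately show ?thesis
    using Q.dim_basis[of ?S] inj S by (auto simp: Q.fin_dim_def Q.basis_def card_image)
qed

section \<open>Comparing two linear maps on one space\<close>


text \<open>
  Both \<open>\<pi>\<close> and \<open>f\<close> identify the quotient with \<open>V / (K + N)\<close>, so its dimension is
  \<open>dim f(V) - dim f(K)\<close>. To see this concretely, extend a basis \<open>C\<close> of \<open>f(K)\<close> to a basis \<open>D\<close>
  of \<open>f(V)\<close>: preimages of the added vectors \<open>E\<close> under \<open>f\<close> are mapped by \<open>\<pi>\<close> to a basis
  of \<open>\<pi>(V)\<close> modulo \<open>\<pi>(N)\<close>. Since \<open>card E = card D - card C\<close> and \<open>card D \<le> card T\<close>, the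
  value \<open>card T\<close> is attained exactly if \<open>C\<close> is empty and \<open>D\<close> spans the same space as \<open>T\<close>.
\<close>
lemma quotient_dim_image_preimage:
  fixes \<pi> :: "'u::real_vector \<Rightarrow> 'w::real_vector" and f :: "'u \<Rightarrow> 'v::ab_group_add"
    and s :: "real \<Rightarrow> 'v \<Rightarrow> 'v" and T :: "'v set"
  defines "K \<equiv> lin_kernel \<pi>" and "N \<equiv> lin_kernel f" and "V \<equiv> f -` module.span s T"
  assumes pi: "linear \<pi>" and f: "Vector_Spaces.linear scaleR s f"
    and T: "finite T" "\<not> module.dependent s T"
    and KV: "K \<subseteq> V"
  shows "quotient_fin_dim (\<pi> ` V) (\<pi> ` N)
    \<and> quotient_dim (\<pi> ` V) (\<pi> ` N) \<le> card T
    \<and> (quotient_dim (\<pi> ` V) (\<pi> ` N) = card T \<longleftrightarrow> K \<subseteq> N \<and> module.span s T \<subseteq> range f)"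
proof -
  interpret f: Vector_Spaces.linear scaleR s f by (rule f)
  interpret pi: Vector_Spaces.linear scaleR scaleR \<pi>
    using pi by (simp add: linear_def real_scaleR_def)
  note [simp] = f.add f.diff f.scale f.sum pi.add pi.diff pi.scale pi.sum
  have K: "real_vector.subspace K"
    unfolding K_def lin_kernel_def by (rule real_vector.linear_subspace_kernel[OF pi])
  have N: "real_vector.subspace N"
    unfolding N_def lin_kernel_def unfolding subspace_raw_def by (rule f.subspace_kernel)
  have V: "real_vector.subspace V"
    unfolding V_def subspace_raw_def by (rule f.subspace_vimage) (rule f.vs2.subspace_span)
  have NV: "N \<subseteq> V"
    by (auto simp: N_def V_def lin_kernel_def f.vs2.span_zero)
  obtain C where C: "C \<subseteq> f ` K" "f.vs2.independent C" "f ` K \<subseteq> f.vs2.span C"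
    using f.vs2.maximal_independent_subset by blast
  have "C \<subseteq> f ` V" using C(1) KV by blast
  then obtain D where D: "C \<subseteq> D" "D \<subseteq> f ` V" "f.vs2.independent D" "f ` V \<subseteq> f.vs2.span D"
    using f.vs2.maximal_independent_subset_extend C(2) by metis
  have spanC: "f.vs2.span C = f ` K"
    using C f.vs2.span_minimal[OF C(1) f.subspace_image[OF K[unfolded subspace_raw_def]]] by blast
  have spanD: "f.vs2.span D = f ` V"
    using D f.vs2.span_minimal[OF D(2) f.subspace_image[OF V[unfolded subspace_raw_def]]] by blast
  have "D \<subseteq> f.vs2.span T" using D(2) by (auto simp: V_def)
  with f.vs2.independent_span_bound[OF T(1) D(3)]
  have finD: "finite D" and DT: "card D \<le> card T" by auto
  then have finC: "finite C" using D(1) finite_subset by blast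
  define E where "E = D - C"
  have finE: "finite E" and DE: "D = C \<union> E" "C \<inter> E = {}"
    using finD D(1) by (auto simp: E_def)
  have cardD: "card D = card C + card E"
    unfolding DE(1) using finC finE DE(2) by (rule card_Un_disjoint)
  have "\<forall>e\<in>E. \<exists>v\<in>V. f v = e" using D(2) by (auto simp: E_def)
  then obtain p where p: "\<And>e. e \<in> E \<Longrightarrow> p e \<in> V" "\<And>e. e \<in> E \<Longrightarrow> f (p e) = e"
    by metis
  have fp: "f (\<Sum>e\<in>E. c e *\<^sub>R p e) = (\<Sum>e\<in>E. s (c e) e)" for c
    using p(2) by simp
  have pip: "\<pi> (\<Sum>e\<in>E. c e *\<^sub>R p e) = (\<Sum>e\<in>E. c e *\<^sub>R \<pi> (p e))" for c
    by simp
  have "quotient_fin_dim (\<pi> ` V) (\<pi> ` N) \<and> quotient_dim (\<pi> ` V) (\<pi> ` N) = card E"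
  proof (rule quotient_dim_eq_card)
    show "real_vector.subspace (\<pi> ` V)" by (rule real_vector.linear_subspace_image[OF pi V])
    show "real_vector.subspace (\<pi> ` N)" by (rule real_vector.linear_subspace_image[OF pi N])
    show "\<pi> ` N \<subseteq> \<pi> ` V" using NV by blast
    show "finite E" by (rule finE)
    show "(\<lambda>e. \<pi> (p e)) ` E \<subseteq> \<pi> ` V" using p(1) by blast
  next
    fix c e assume "(\<Sum>e\<in>E. c e *\<^sub>R \<pi> (p e)) \<in> \<pi> ` N" and e: "e \<in> E"
    then obtain n where n: "n \<in> N" "\<pi> (\<Sum>e\<in>E. c e *\<^sub>R p e) = \<pi> n"
      unfolding pip by auto
    \<comment> \<open>The combination of preimages differs from \<open>n\<close> by an element of \<open>K\<close>, so its image under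
      \<open>f\<close>, a combination of \<open>E\<close>, lies in the span of \<open>C\<close>; this contradicts the independence of
      \<open>C \<union> E\<close> unless all coefficients vanish.\<close>
    define k where "k = (\<Sum>e\<in>E. c e *\<^sub>R p e) - n"
    have "k \<in> K" using n(2) by (simp only: k_def K_def lin_kernel_def pi.diff mem_Collect_eq) simp
    moreover have "f k = (\<Sum>e\<in>E. s (c e) e)"
      using n(1) fp[of c] by (simp only: k_def N_def lin_kernel_def f.diff mem_Collect_eq) simp
    ultimately have "(\<Sum>e\<in>E. s (c e) e) \<in> f.vs2.span C" unfolding spanC by (metis imageI)
    then obtain b where b: "(\<Sum>e\<in>E. s (c e) e) = (\<Sum>e\<in>C. s (b e) e)"
      unfolding f.vs2.span_finite[OF finC] by auto
    define r where "r e = (if e \<in> E then c e else - b e)" for e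
    have "(\<Sum>e\<in>D. s (r e) e) = (\<Sum>e\<in>C. s (r e) e) + (\<Sum>e\<in>E. s (r e) e)"
      unfolding DE(1) using finC finE DE(2) by (rule sum.union_disjoint)
    also have "(\<Sum>e\<in>C. s (r e) e) = (\<Sum>e\<in>C. - s (b e) e)"
      using DE(2) by (intro sum.cong) (auto simp: r_def)
    also have "\<dots> = - (\<Sum>e\<in>C. s (b e) e)" by (simp add: sum_negf)
    also have "(\<Sum>e\<in>E. s (r e) e) = (\<Sum>e\<in>E. s (c e) e)"
      by (intro sum.cong) (auto simp: r_def)
    finally have "(\<Sum>e\<in>D. s (r e) e) = 0" using b by simp
    then have "r e = 0" using f.vs2.independentD[OF D(3) finD] e DE(1) by blast
    then show "c e = 0" using e by (simp add: r_def)
  next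
    fix a assume "a \<in> \<pi> ` V"
    then obtain x where x: "x \<in> V" "a = \<pi> x" by blast
    then have "f x \<in> f.vs2.span D" unfolding spanD by blast
    then obtain r where "f x = (\<Sum>e\<in>D. s (r e) e)"
      unfolding f.vs2.span_finite[OF finD] by auto
    also have "\<dots> = (\<Sum>e\<in>C. s (r e) e) + (\<Sum>e\<in>E. s (r e) e)"
      unfolding DE(1) using finC finE DE(2) by (rule sum.union_disjoint)
    finally have fx: "f x = (\<Sum>e\<in>C. s (r e) e) + (\<Sum>e\<in>E. s (r e) e)" .
    have "(\<Sum>e\<in>C. s (r e) e) \<in> f ` K"
      unfolding spanC[symmetric] by (intro f.vs2.span_sum f.vs2.span_scale f.vs2.span_base)
    then obtain k where k: "k \<in> K" "(\<Sum>e\<in>C. s (r e) e) = f k" by blast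
    \<comment> \<open>Subtracting both parts of \<open>f x\<close> leaves an element of \<open>N\<close>; the part \<open>k\<close> that accounts
      for \<open>C\<close> is invisible under \<open>\<pi>\<close>.\<close>
    define n where "n = x - (\<Sum>e\<in>E. r e *\<^sub>R p e) - k"
    have "f n = 0" unfolding n_def f.diff fp fx k(2) by simp
    then have "n \<in> N" by (simp add: N_def lin_kernel_def)
    moreover have "a - (\<Sum>e\<in>E. r e *\<^sub>R \<pi> (p e)) = \<pi> n"
      using k(1) unfolding n_def pi.diff pip x(2) by (simp add: K_def lin_kernel_def)
    ultimately show "\<exists>c. a - (\<Sum>e\<in>E. c e *\<^sub>R \<pi> (p e)) \<in> \<pi> ` N" by blast
  qed
  moreover have "card E = card T \<longleftrightarrow> K \<subseteq> N \<and> f.vs2.span T \<subseteq> range f"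
  proof
    assume *: "card E = card T"
    then have "C = {}" "card D = card T" using cardD DT finC by auto
    then have "f ` K \<subseteq> {0}" using spanC by simp
    then have "K \<subseteq> N" by (auto simp: N_def lin_kernel_def)
    moreover have "T \<subseteq> f.vs2.span D"
    proof (rule ccontr)
      assume "\<not> T \<subseteq> f.vs2.span D"
      then obtain t where t: "t \<in> T" "t \<notin> f.vs2.span D" by blast
      then have "f.vs2.independent (insert t D)" using D(3) by (intro f.vs2.independent_insertI)
      moreover have "insert t D \<subseteq> f.vs2.span T"
        using \<open>D \<subseteq> f.vs2.span T\<close> t(1) f.vs2.span_base by blast
      ultimately have "card (insert t D) \<le> card T"
        using f.vs2.independent_span_bound[OF T(1)] by blast
      moreover have "t \<notin> D" using t(2) f.vs2.span_base by blast
      ultimately show False using \<open>card D = card T\<close> finD by simp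
    qed
    then have "f.vs2.span T \<subseteq> f.vs2.span D"
      by (rule f.vs2.span_minimal) (rule f.vs2.subspace_span)
    ultimately show "K \<subseteq> N \<and> f.vs2.span T \<subseteq> range f" unfolding spanD by blast
  next
    assume *: "K \<subseteq> N \<and> f.vs2.span T \<subseteq> range f"
    then have "C \<subseteq> {0}" using C(1) by (auto simp: N_def lin_kernel_def)
    then have "C = {}" using C(2) f.vs2.dependent_zero by blast
    have "T \<subseteq> f ` V"
    proof
      fix t assume "t \<in> T"
      then have "t \<in> f.vs2.span T" by (rule f.vs2.span_base)
      then show "t \<in> f ` V" using * unfolding V_def by blast
    qed
    then have "card T \<le> card D"
      using f.vs2.independent_span_bound[OF finD T(2)] unfolding spanD by blast
    then show "card E = card T" using DT cardD \<open>C = {}\<close> by simp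
  qed
  ultimately show ?thesis using cardD DT by auto
qed

section \<open>Powers of a finite-dimensional subspace\<close>

text \<open>
  This is the scalar multiplication with which functions enter the \<open>vector_space\<close> locale;
  the addition that goes with it is the pointwise one of the type class.
\<close>
definition pointwise_scale :: "real \<Rightarrow> ('i \<Rightarrow> 'v::real_vector) \<Rightarrow> 'i \<Rightarrow> 'v" where
  "pointwise_scale c f = (\<lambda>i. c *\<^sub>R f i)"

lemma vector_space_pointwise_scale: "vector_space pointwise_scale"
  by unfold_locales (auto simp: pointwise_scale_def fun_eq_iff algebra_simps)

lemma sum_fun_apply: "(\<Sum>a\<in>A. F a) i = (\<Sum>a\<in>A. F a i)"
  for F :: "'a \<Rightarrow> 'i \<Rightarrow> 'v::comm_monoid_add"
  by (induction A rule: infinite_finite_induct) auto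

text \<open>
  The power \<open>(span B)\<^sup>I\<close> is realised by functions that vanish outside \<open>I\<close>, since these, in
  contrast to extensional functions, are closed under the pointwise addition. Its basis
  consists of the functions with a single nonzero value, taken from \<open>B\<close>.
\<close>
lemma power_of_subspace_basis:
  fixes B :: "'v::real_vector set" and I :: "'i set"
  assumes I: "finite I" and B: "finite B" "independent B"
  obtains T :: "('i \<Rightarrow> 'v) set" where
    "finite T" "card T = card B * card I" "\<not> module.dependent pointwise_scale T"
    "module.span pointwise_scale T = {f. (\<forall>i\<in>I. f i \<in> span B) \<and> (\<forall>i. i \<notin> I \<longrightarrow> f i = 0)}"
proof -
  interpret F: vector_space "pointwise_scale :: real \<Rightarrow> ('i \<Rightarrow> 'v) \<Rightarrow> _"
    by (rule vector_space_pointwise_scale)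
  define e :: "'i \<times> 'v \<Rightarrow> 'i \<Rightarrow> 'v" where "e = (\<lambda>(i, b) j. if j = i then b else 0)"
  have nz: "b \<noteq> 0" if "b \<in> B" for b using that B(2) real_vector.dependent_zero by blast
  have inj: "inj_on e (I \<times> B)"
  proof (rule inj_onI, clarify)
    fix i b i' b' assume *: "b \<in> B" "b' \<in> B" "e (i, b) = e (i', b')"
    from fun_cong[OF *(3), of i] nz[OF *(1)] show "i = i' \<and> b = b'"
      by (auto simp: e_def split: if_splits)
  qed
  have comb: "(\<Sum>t\<in>e ` (I \<times> B). pointwise_scale (c t) t) i
      = (if i \<in> I then \<Sum>b\<in>B. c (e (i, b)) *\<^sub>R b else 0)" for c i
  proof -
    have "(\<Sum>t\<in>e ` (I \<times> B). pointwise_scale (c t) t) i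
        = (\<Sum>x\<in>I \<times> B. c (e x) *\<^sub>R e x i)"
      by (simp add: sum.reindex[OF inj] sum_fun_apply pointwise_scale_def)
    also have "\<dots> = (\<Sum>j\<in>I. \<Sum>b\<in>B. c (e (j, b)) *\<^sub>R e (j, b) i)"
      by (simp add: sum.cartesian_product)
    also have "\<dots> = (\<Sum>j\<in>I. if i = j then \<Sum>b\<in>B. c (e (j, b)) *\<^sub>R b else 0)"
      by (intro sum.cong) (auto simp: e_def)
    finally show ?thesis using I by simp
  qed
  have fin: "finite (e ` (I \<times> B))" using I B(1) by simp
  show thesis
  proof (rule that)
    show "finite (e ` (I \<times> B))" by (rule fin)
    show "card (e ` (I \<times> B)) = card B * card I"
      by (simp add: card_image[OF inj] card_cartesian_product)
    show "F.independent (e ` (I \<times> B))"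
    proof (rule F.independent_if_scalars_zero[OF fin])
      fix c t assume 0: "(\<Sum>t\<in>e ` (I \<times> B). pointwise_scale (c t) t) = 0" and "t \<in> e ` (I \<times> B)"
      then obtain i b where t: "i \<in> I" "b \<in> B" "t = e (i, b)" by blast
      have "(\<Sum>b\<in>B. c (e (i, b)) *\<^sub>R b) = 0"
        using fun_cong[OF 0, of i] t(1) by (simp only: comb) simp
      from real_vector.independentD[OF B(2,1) subset_refl this t(2)] show "c t = 0"
        using t(3) by simp
    qed
    show "F.span (e ` (I \<times> B)) = {f. (\<forall>i\<in>I. f i \<in> span B) \<and> (\<forall>i. i \<notin> I \<longrightarrow> f i = 0)}"
      (is "_ = ?P")
    proof (intro equalityI subsetI)
      fix f assume "f \<in> F.span (e ` (I \<times> B))"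
      then obtain c where "f = (\<Sum>t\<in>e ` (I \<times> B). pointwise_scale (c t) t)"
        unfolding F.span_finite[OF fin] by blast
      then show "f \<in> ?P"
        by (auto simp: comb intro!: real_vector.span_sum intro: real_vector.span_scale real_vector.span_base)
    next
      fix f assume f: "f \<in> ?P"
      then have "\<forall>i\<in>I. \<exists>r. f i = (\<Sum>b\<in>B. r b *\<^sub>R b)"
        unfolding real_vector.span_finite[OF B(1)] by blast
      then obtain r where r: "\<And>i. i \<in> I \<Longrightarrow> f i = (\<Sum>b\<in>B. r i b *\<^sub>R b)" by metis
      define c where "c = (\<lambda>(i, b). r i b) \<circ> the_inv_into (I \<times> B) e"
      have c: "c (e (i, b)) = r i b" if "i \<in> I" "b \<in> B" for i b
        using that the_inv_into_f_f[OF inj, of "(i, b)"] by (simp add: c_def)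
      have "f = (\<Sum>t\<in>e ` (I \<times> B). pointwise_scale (c t) t)"
        using f r c by (auto simp: fun_eq_iff comb)
      then show "f \<in> F.span (e ` (I \<times> B))" unfolding F.span_finite[OF fin] by blast
    qed
  qed
qed

section \<open>Invariants of a generated group\<close>

text \<open>The stabilizer of a vector is a subgroup, so it is all of \<open>G\<close> once it contains generators.\<close>
lemma fixed_space_generate:
  assumes act: "group_action G UNIV \<phi>" and S: "S \<subseteq> carrier G" and gen: "generate G S = carrier G"
  shows "fixed_space G \<phi> = {v. \<forall>h\<in>S. \<phi> h v = v}"
proof (intro equalityI subsetI)
  fix v assume "v \<in> fixed_space G \<phi>"
  then show "v \<in> {v. \<forall>h\<in>S. \<phi> h v = v}" using S by (auto simp: fixed_space_def)
next
  fix v assume v: "v \<in> {v. \<forall>h\<in>S. \<phi> h v = v}"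
  interpret group_action G UNIV \<phi> by (rule act)
  have "subgroup (stabilizer G \<phi> v) G" by (rule stabilizer_subgroup) simp
  moreover have "S \<subseteq> stabilizer G \<phi> v" using v S by (auto simp: stabilizer_def)
  ultimately have "generate G S \<subseteq> stabilizer G \<phi> v"
    using group.generate_subgroup_incl[OF group_hom.axioms(1)[OF group_hom]] by blast
  then show "v \<in> fixed_space G \<phi>" by (auto simp: gen fixed_space_def stabilizer_def)
qed

section \<open>The dimension of the obstruction to lifting invariants\<close>

theorem proposition1p1:
  fixes G :: "('g, 'b) monoid_scheme"
    and \<phi> :: "'g \<Rightarrow> 'u::real_vector \<Rightarrow> 'u"
    and \<psi> :: "'g \<Rightarrow> 'w::real_vector \<Rightarrow> 'w"
    and \<pi> :: "'u \<Rightarrow> 'w"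
    and g :: "nat \<Rightarrow> 'g"
    and m d :: nat
  assumes "linear \<pi>"
    and "linear_action G \<phi>"
    and "linear_action G \<psi>"
    and "\<And>h u. h \<in> carrier G \<Longrightarrow> \<psi> h (\<pi> u) = \<pi> (\<phi> h u)"
    and "\<exists>B. finite B \<and> span B = lin_kernel \<pi>"
    and "m = dim (lin_kernel \<pi>)"
    and "g ` {1..d} \<subseteq> carrier G"
    and "generate G (g ` {1..d}) = carrier G"
  shows "quotient_fin_dim (range \<pi> \<inter> fixed_space G \<psi>) (\<pi> ` fixed_space G \<phi>)
      \<and> quotient_dim (range \<pi> \<inter> fixed_space G \<psi>) (\<pi> ` fixed_space G \<phi>) \<le> m * d
      \<and> (quotient_dim (range \<pi> \<inter> fixed_space G \<psi>) (\<pi> ` fixed_space G \<phi>) = m * d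
          \<longleftrightarrow> lin_kernel \<pi> \<subseteq> fixed_space G \<phi>
            \<and> ({1..d} \<rightarrow>\<^sub>E lin_kernel \<pi>) \<subseteq> range (displacement \<phi> d g))"
proof -
  let ?K = "lin_kernel \<pi>"
  note equiv = assms(4)
  have gG: "g i \<in> carrier G" if "i \<in> {1..d}" for i using that assms(7) by blast
  have fixU: "fixed_space G \<phi> = {u. \<forall>i\<in>{1..d}. \<phi> (g i) u = u}"
    using fixed_space_generate[of G \<phi>, OF _ assms(7,8)] assms(2) by (simp add: linear_action_def)
  have fixW: "fixed_space G \<psi> = {w. \<forall>i\<in>{1..d}. \<psi> (g i) w = w}"
    using fixed_space_generate[of G \<psi>, OF _ assms(7,8)] assms(3) by (simp add: linear_action_def)

  obtain A where A: "finite A" "span A = ?K" using assms(5) by blast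
  obtain B where B: "B \<subseteq> ?K" "independent B" "?K \<subseteq> span B" "card B = dim ?K"
    by (rule real_vector.basis_exists)
  have finB: "finite B" using real_vector.independent_span_bound[OF A(1) B(2)] B(1) A(2) by simp
  have spanB: "span B = ?K"
    using B A(2) by (metis real_vector.span_minimal real_vector.subspace_span subset_antisym)
  obtain T :: "(nat \<Rightarrow> 'u) set" where T: "finite T" "card T = card B * card {1..d}"
    "\<not> module.dependent pointwise_scale T"
    "module.span pointwise_scale T = {f. (\<forall>i\<in>{1..d}. f i \<in> span B) \<and> (\<forall>i. i \<notin> {1..d} \<longrightarrow> f i = 0)}"
    by (rule power_of_subspace_basis[OF finite_atLeastAtMost finB B(2)])
  have cardT: "card T = m * d" using T(2) B(4) assms(6) by simp

  \<comment> \<open>\<open>f\<close> is the displacement with value \<open>0\<close> instead of \<open>undefined\<close> outside \<open>{1..d}\<close>; only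
    this version is linear for the pointwise operations.\<close>
  define f where "f u = (\<lambda>i. if i \<in> {1..d} then \<phi> (g i) u - u else 0)" for u
  have lin: "linear (\<phi> (g i))" if "i \<in> {1..d}" for i
    using gG[OF that] assms(2) by (simp add: linear_action_def)
  have "Vector_Spaces.linear scaleR pointwise_scale f"
  proof (intro Vector_Spaces.linear.intro module_hom.intro module_hom_axioms.intro)
    show "f (x + y) = f x + f y" for x y
      using linear_add[OF lin] by (auto simp: f_def fun_eq_iff)
    show "f (c *\<^sub>R x) = pointwise_scale c (f x)" for c x
      using linear_scale[OF lin] by (auto simp: f_def fun_eq_iff pointwise_scale_def scaleR_diff_right)
  qed (use vector_space_pointwise_scale real_vector.vector_space_axioms in
      \<open>simp_all add: module_iff_vector_space\<close>)
  moreover have fN: "lin_kernel f = fixed_space G \<phi>"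
    by (auto simp: lin_kernel_def fixU f_def fun_eq_iff)
  have V: "u \<in> f -` module.span pointwise_scale T \<longleftrightarrow> \<pi> u \<in> fixed_space G \<psi>" for u
    using equiv[OF gG, of _ u] linear_diff[OF assms(1)]
    by (auto simp: T(4) spanB fixW f_def lin_kernel_def)
  have piV: "\<pi> ` (f -` module.span pointwise_scale T) = range \<pi> \<inter> fixed_space G \<psi>"
    using V by auto
  have KV: "?K \<subseteq> f -` module.span pointwise_scale T"
  proof
    fix u assume "u \<in> ?K"
    moreover have "\<psi> (g i) 0 = 0" if "i \<in> {1..d}" for i
      using equiv[OF gG[OF that], of 0] linear_0[OF lin[OF that]] linear_0[OF assms(1)] by simp
    ultimately have "\<pi> u \<in> fixed_space G \<psi>" by (simp add: fixW lin_kernel_def)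
    then show "u \<in> f -` module.span pointwise_scale T" by (simp only: V)
  qed
  \<comment> \<open>Extensional functions on \<open>{1..d}\<close> and functions that vanish outside \<open>{1..d}\<close> correspond
    to each other, and so do the two versions of the displacement.\<close>
  have "module.span pointwise_scale T \<subseteq> range f
      \<longleftrightarrow> ({1..d} \<rightarrow>\<^sub>E ?K) \<subseteq> range (displacement \<phi> d g)" (is "?l \<longleftrightarrow> ?r")
  proof
    assume l: ?l
    show ?r
    proof
      fix h assume h: "h \<in> {1..d} \<rightarrow>\<^sub>E ?K"
      define h0 where "h0 i = (if i \<in> {1..d} then h i else 0)" for i
      have "h0 \<in> module.span pointwise_scale T"
        using h by (auto simp: T(4) spanB h0_def)
      then obtain u where "h0 = f u" using l by blast
      then have "h = displacement \<phi> d g u"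
        using h by (intro PiE_ext[of h "{1..d}" "\<lambda>_. UNIV"])
          (auto simp: displacement_def f_def h0_def fun_eq_iff PiE_iff split: if_splits)
      then show "h \<in> range (displacement \<phi> d g)" by blast
    qed
  next
    assume r: ?r
    show ?l
    proof
      fix h assume h: "h \<in> module.span pointwise_scale T"
      then have "restrict h {1..d} \<in> {1..d} \<rightarrow>\<^sub>E ?K" by (auto simp: T(4) spanB)
      then obtain u where u: "restrict h {1..d} = displacement \<phi> d g u" using r by blast
      have "h = f u"
      proof
        fix i show "h i = f u i"
          using h fun_cong[OF u, of i] by (auto simp: T(4) f_def displacement_def)
      qed
      then show "h \<in> range f" by blast
    qed
  qed
  ultimately show ?thesis
    using quotient_dim_image_preimage[OF assms(1) _ T(1,3) KV] unfolding fN piV cardT by simp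
qed

end
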